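(* (1) For all $\lambda$-terms $t,u$: if $t\to_\beta^* u$ then there is $s$ with $t\to_{\ell\ell}^* s\to_{\neg\ell\ell}^* u$. (2) $\to_{\ell\ell}$ is a normalizing reduction for $\to_\beta$: $\to_{\ell\ell}\subseteq\to_\beta$, $\to_{\ell\ell}$ and $\to_\beta$ have the same normal forms, and every term that is weakly $\to_\beta$-normalizing is strongly $\to_{\ell\ell}$-normalizing.
   Context: $\lambda$-terms: $t,s::=x\mid\lambda x.t\mid ts$ (up to $\alpha$-equivalence); $t\{x:=s\}$ capture-avoiding substitution. $\beta$-reduction of level $k\in\mathbb N$, $\to_{\beta:k}$: $(\lambda x.t)s\to_{\beta:0}t\{x:=s\}$; if $t\to_{\beta:k}t'$ then $\lambda x.t\to_{\beta:k}\lambda x.t'$, $ts\to_{\beta:k}t's$, and $st\to_{\beta:k+1}st'$. Then $\to_\beta=\bigcup_k\to_{\beta:k}$. The least level $\mathrm{deg}(t)\in\mathbb N\cup\{\infty\}$: $\mathrm{deg}(x)=\infty$, $\mathrm{deg}(\lambda x.t)=\mathrm{deg}(t)$, $\mathrm{deg}(ts)=0$ if $t$ is an abstraction and $\min\{\mathrm{deg}(t),\mathrm{deg}(s)+1\}$ otherwise (with $\infty+1=\infty$). Least-level reduction: $t\to_{\ell\ell}s$ iff $t\to_{\beta:k}s$ with $k=\mathrm{deg}(t)$; $t\to_{\neg\ell\ell}s$ iff $t\to_{\beta:k}s$ with $\mathrm{deg}(t)<k\in\mathbb N$. A term is $\to$-normal if it has no $\to$-step; weakly $\to$-normalizing if it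 reduces by $\to^*$ to a $\to$-normal term; strongly $\to$-normalizing if there is no infinite $\to$-sequence from it. *)

theory Defs
  imports Main "HOL-Library.Extended_Nat"
begin

text \<open>
  Terms modulo alpha-equivalence are represented with de Bruijn indices: an index pointing beyond
  the enclosing abstractions denotes a free variable.
\<close>

datatype lterm = Var nat | App lterm lterm | Lam lterm

fun is_abs :: "lterm \<Rightarrow> bool" where
  "is_abs (Lam t) = True"
| "is_abs (Var i) = False"
| "is_abs (App t s) = False"

primrec lift :: "nat \<Rightarrow> lterm \<Rightarrow> lterm" where
  "lift c (Var i) = (if i < c then Var i else Var (Suc i))"
| "lift c (App t s) = App (lift c t) (lift c s)"
| "lift c (Lam t) = Lam (lift (Suc c) t)"

text \<open>
  \<^term>\<open>subst x s t\<close> is capture-avoiding substitution of \<open>s\<close> for the variable \<open>x\<close> in \<open>t\<close>; as \<open>x\<close>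
  is eliminated (its binder is consumed by the contraction), larger indices are decremented.
\<close>

primrec subst :: "nat \<Rightarrow> lterm \<Rightarrow> lterm \<Rightarrow> lterm" where
  "subst x s (Var i) = (if i < x then Var i else if i = x then s else Var (i - 1))"
| "subst x s (App t u) = App (subst x s t) (subst x s u)"
| "subst x s (Lam t) = Lam (subst (Suc x) (lift 0 s) t)"

inductive beta_level :: "nat \<Rightarrow> lterm \<Rightarrow> lterm \<Rightarrow> bool" where
  root: "beta_level 0 (App (Lam t) s) (subst 0 s t)"
| lam: "beta_level k t t' \<Longrightarrow> beta_level k (Lam t) (Lam t')"
| appL: "beta_level k t t' \<Longrightarrow> beta_level k (App t s) (App t' s)"
| appR: "beta_level k t t' \<Longrightarrow> beta_level (Suc k) (App s t) (App s t')"

definition beta :: "lterm \<Rightarrow> lterm \<Rightarrow> bool" where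
  "beta t s \<longleftrightarrow> (\<exists>k. beta_level k t s)"

primrec deg :: "lterm \<Rightarrow> enat" where
  "deg (Var i) = \<infinity>"
| "deg (App t s) = (if is_abs t then 0 else min (deg t) (deg s + 1))"
| "deg (Lam t) = deg t"

definition ll :: "lterm \<Rightarrow> lterm \<Rightarrow> bool" where
  "ll t s \<longleftrightarrow> (\<exists>k. enat k = deg t \<and> beta_level k t s)"

definition nll :: "lterm \<Rightarrow> lterm \<Rightarrow> bool" where
  "nll t s \<longleftrightarrow> (\<exists>k. deg t < enat k \<and> beta_level k t s)"

definition normal :: "('a \<Rightarrow> 'a \<Rightarrow> bool) \<Rightarrow> 'a \<Rightarrow> bool" where
  "normal r t \<longleftrightarrow> (\<nexists>s. r t s)"

definition weakly_normalizing :: "('a \<Rightarrow> 'a \<Rightarrow> bool) \<Rightarrow> 'a \<Rightarrow> bool" where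
  "weakly_normalizing r t \<longleftrightarrow> (\<exists>s. r\<^sup>*\<^sup>* t s \<and> normal r s)"

definition strongly_normalizing :: "('a \<Rightarrow> 'a \<Rightarrow> bool) \<Rightarrow> 'a \<Rightarrow> bool" where
  "strongly_normalizing r t \<longleftrightarrow> (\<nexists>f :: nat \<Rightarrow> 'a. f 0 = t \<and> (\<forall>i. r (f i) (f (Suc i))))"

definition normalizing_reduction_for ::
  "('a \<Rightarrow> 'a \<Rightarrow> bool) \<Rightarrow> ('a \<Rightarrow> 'a \<Rightarrow> bool) \<Rightarrow> bool" where
  "normalizing_reduction_for e r \<longleftrightarrow>
     (\<forall>t s. e t s \<longrightarrow> r t s) \<and>
     (\<forall>t. normal e t \<longleftrightarrow> normal r t) \<and>
     (\<forall>t. weakly_normalizing r t \<longrightarrow> strongly_normalizing e t)"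

end

theory Submission imports Defs begin

text \<open>
  Let \<open>par k\<close> be parallel reduction contracting only redexes of level at least \<open>k\<close>. Every such step
  preserves \<open>min k (deg t)\<close>, since redexes of level below \<open>k\<close> are neither created nor erased. A
  step of \<open>par k\<close> factors, in Takahashi's style, into level-\<open>k\<close> steps followed by one step of
  \<open>par (Suc k)\<close>; iterating from level \<open>0\<close>, and stopping at the latest when the level exceeds the
  size of the target, splits any parallel step into least-level steps followed by a parallel step
  above the least level. Conversely, a parallel step above the least level followed by a least-level
  step merges into one parallel step, and the two facts together give factorization. For
  normalization, steps above the least level never reach a normal form, so a weakly normalizing term
  reaches its normal form by least-level steps alone; as \<open>beta_level k\<close> has the diamond property,
  all least-level sequences then have the same length.
\<close>

section \<open>Substitution in de Bruijn terms\<close>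

lemma lift_lift: "i \<le> k \<Longrightarrow> lift (Suc k) (lift i t) = lift i (lift k t)"
  by (induction t arbitrary: i k) auto

lemma lift_subst_ge: "j \<le> i \<Longrightarrow> lift i (subst j s t) = subst j (lift i s) (lift (Suc i) t)"
  by (induction t arbitrary: i j s) (auto simp: lift_lift)

lemma lift_subst_le: "i \<le> j \<Longrightarrow> lift i (subst j s t) = subst (Suc j) (lift i s) (lift i t)"
  by (induction t arbitrary: i j s) (auto simp: lift_lift)

lemma subst_lift [simp]: "subst k s (lift k t) = t"
  by (induction t arbitrary: k s) auto

text \<open>The substitution lemma in de Bruijn form: it makes contraction of a redex commute with
  substitution.\<close>

lemma subst_subst:
  "i \<le> j \<Longrightarrow> subst i (subst j v u) (subst (Suc j) (lift i v) t) = subst j v (subst i u t)"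
  by (induction t arbitrary: i j u v)
     (auto simp: lift_lift [symmetric] lift_subst_le)

section \<open>Reduction of a fixed level\<close>

inductive_cases beta_level_LamE: "beta_level k (Lam t) s"
inductive_cases beta_level_AppE: "beta_level k (App t u) s"

lemma beta_level_lift: "beta_level k t t' \<Longrightarrow> beta_level k (lift c t) (lift c t')"
  by (induction arbitrary: c rule: beta_level.induct)
     (auto intro: beta_level.intros simp: lift_subst_ge beta_level.root)

lemma beta_level_subst: "beta_level k t t' \<Longrightarrow> beta_level k (subst x s t) (subst x s t')"
proof (induction arbitrary: x s rule: beta_level.induct)
  case (root t u)
  show ?case
    using beta_level.root [of "subst (Suc x) (lift 0 s) t" "subst x s u"]
    by (simp add: subst_subst)
qed (auto intro: beta_level.intros)

text \<open>Next to a contracted redex of level \<open>k\<close>, another redex of level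
  \<open>k\<close> can lie in the body of its abstraction but not in its argument, where levels are
  higher. It is thus neither copied nor erased, and its unique residual keeps level
  \<open>k\<close>.\<close>

lemma beta_level_diamond:
  "beta_level k t s1 \<Longrightarrow> beta_level k t s2 \<Longrightarrow>
    s1 = s2 \<or> (\<exists>u. beta_level k s1 u \<and> beta_level k s2 u)"
proof (induction arbitrary: s2 rule: beta_level.induct)
  case (root t s)
  from root.prems show ?case
    by (elim beta_level_AppE)
       (auto elim!: beta_level_LamE intro: beta_level.root beta_level_subst)
next
  case (lam k t t')
  from lam.prems show ?case
    by (elim beta_level_LamE) (use lam.IH in \<open>blast intro: beta_level.lam\<close>)
next
  case (appL k t t' s)
  from appL.prems show ?case
  proof (cases rule: beta_level.cases)
    case (root t1)
    with appL.hyps obtain t1' where "t' = Lam t1'" "beta_level 0 t1 t1'"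
      by (auto elim: beta_level_LamE)
    with root show ?thesis
      by (auto intro: beta_level.root beta_level_subst)
  next
    case (appL t'')
    with appL.IH show ?thesis
      by (blast intro: beta_level.appL)
  next
    case (appR j s')
    with appL.hyps show ?thesis
      by (blast intro: beta_level.appL beta_level.appR)
  qed
next
  case (appR k t t' s)
  from appR.prems show ?case
    by (elim beta_level_AppE)
       (use appR.IH appR.hyps in \<open>blast intro: beta_level.appL beta_level.appR\<close>)+
qed

lemma deg_le_beta_level: "beta_level k t s \<Longrightarrow> deg t \<le> enat k"
proof (induction rule: beta_level.induct)
  case (appR k t t' s)
  from appR.IH show ?case
    by (cases "deg t") (auto simp: min_le_iff_disj one_enat_def zero_enat_def)
qed (auto simp: min_le_iff_disj zero_enat_def)

text \<open>With \<open>deg_le_beta_level\<close>, this makes \<open>deg\<close> the minimum over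
  the levels of all possible steps.\<close>

lemma beta_level_deg: "deg t = enat k \<Longrightarrow> \<exists>s. beta_level k t s"
proof (induction t arbitrary: k)
  case (Var i)
  then show ?case by simp
next
  case (Lam t)
  then show ?case by (auto intro: beta_level.lam)
next
  case (App t u)
  consider t' where "t = Lam t'" | "\<not> is_abs t" by (cases t) auto
  then show ?case
  proof cases
    case 1
    with App.prems have "k = 0" by (simp add: zero_enat_def)
    with 1 show ?thesis by (auto intro: beta_level.root)
  next
    case 2
    with App.prems consider "deg t = enat k" | "deg u + 1 = enat k"
      by (auto simp: min_def split: if_splits)
    then show ?thesis
    proof cases
      case 1
      with App.IH show ?thesis by (blast intro: beta_level.appL)
    next
      case 2
      then obtain j where "deg u = enat j" "k = Suc j"
        by (cases "deg u") (auto simp: one_enat_def)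
      with App.IH show ?thesis by (blast intro: beta_level.appR)
    qed
  qed
qed

section \<open>Parallel reduction from a level on\<close>

text \<open>The predecessor is truncated: an argument of a term reduced from level \<open>0\<close> on is itself
  reduced from level \<open>0\<close> on.\<close>

inductive par :: "nat \<Rightarrow> lterm \<Rightarrow> lterm \<Rightarrow> bool" where
  var: "par k (Var i) (Var i)"
| lam: "par k t t' \<Longrightarrow> par k (Lam t) (Lam t')"
| app: "par k t t' \<Longrightarrow> par (k - 1) s s' \<Longrightarrow> par k (App t s) (App t' s')"
| beta: "par 0 t t' \<Longrightarrow> par 0 s s' \<Longrightarrow> par 0 (App (Lam t) s) (subst 0 s' t')"

lemma par_refl: "par k t t"
  by (induction t arbitrary: k) (auto intro: par.intros)

lemma par_antimono: "par k t s \<Longrightarrow> j \<le> k \<Longrightarrow> par j t s"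
  by (induction arbitrary: j rule: par.induct) (auto intro: par.intros diff_le_mono)

lemma par_beta_level: "beta_level k t s \<Longrightarrow> par k t s"
  by (induction rule: beta_level.induct) (auto intro: par.intros par_refl)

lemma par_lift: "par k t t' \<Longrightarrow> par k (lift c t) (lift c t')"
proof (induction arbitrary: c rule: par.induct)
  case (beta t t' s s')
  then show ?case
    using par.beta [of "lift (Suc c) t" "lift (Suc c) t'" "lift c s" "lift c s'"]
    by (simp add: lift_subst_ge)
qed (auto intro: par.intros)

text \<open>Copies of \<open>s\<close> placed inside arguments only have to reduce from a lower
  level on, which \<open>par_antimono\<close> provides.\<close>

lemma par_subst: "par k t t' \<Longrightarrow> par k s s' \<Longrightarrow> par k (subst x s t) (subst x s' t')"
proof (induction arbitrary: x s s' rule: par.induct)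
  case (app k t t' u u')
  moreover from app.prems have "par (k - 1) s s'" by (rule par_antimono) simp
  ultimately show ?case by (simp add: par.app)
next
  case (beta t t' u u')
  then show ?case
    using par.beta [of "subst (Suc x) (lift 0 s) t" "subst (Suc x) (lift 0 s') t'"
        "subst x s u" "subst x s' u'"]
    by (simp add: subst_subst par_lift)
qed (simp_all add: par.var par.lam par_lift)

text \<open>From a positive level on, a redex at the root is out of reach, so the outermost
  constructor persists.\<close>

lemma par_Suc_is_abs: "par (Suc k) t s \<Longrightarrow> is_abs s \<longleftrightarrow> is_abs t"
  by (cases rule: par.cases) auto

lemma par_LamD: "par (Suc k) t (Lam s) \<Longrightarrow> \<exists>t'. t = Lam t' \<and> par (Suc k) t' s"
  by (cases rule: par.cases) auto

lemma par_min_deg: "par k t s \<Longrightarrow> min (enat k) (deg s) = min (enat k) (deg t)"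
proof (induction rule: par.induct)
  case (app k t t' s s')
  show ?case
  proof (cases k)
    case 0
    then show ?thesis by (simp add: zero_enat_def [symmetric])
  next
    case (Suc j)
    then have abs: "is_abs t' \<longleftrightarrow> is_abs t"
      using app.hyps(1) par_Suc_is_abs by blast
    have "min (enat k) (deg s' + 1) = min (enat k) (deg s + 1)"
      using app.IH(2) Suc
      by (cases "deg s"; cases "deg s'") (auto simp: one_enat_def min_def split: if_splits)
    with app.IH(1) have "min (enat k) (min (deg t') (deg s' + 1)) =
        min (enat k) (min (deg t) (deg s + 1))"
      by (metis min.assoc min.left_commute)
    with abs show ?thesis by simp
  qed
qed (auto simp: zero_enat_def [symmetric])

lemma par_deg_eq: "par k t s \<Longrightarrow> deg t < enat k \<Longrightarrow> deg s = deg t"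
  using par_min_deg [of k t s] by (auto simp: min_def split: if_splits)

lemma par_le_deg: "par k t s \<Longrightarrow> enat k \<le> deg t \<Longrightarrow> enat k \<le> deg s"
  using par_min_deg [of k t s] by (auto simp: min_def split: if_splits)

section \<open>Merging and splitting parallel steps\<close>

text \<open>A redex of \<open>s\<close> of level below \<open>k\<close> stems from a redex of
  \<open>t\<close> at the same place, as \<open>par k\<close> leaves that part of the term intact.
  It can therefore be contracted together with the others.\<close>

lemma par_merge: "beta_level j s u \<Longrightarrow> par k t s \<Longrightarrow> j < k \<Longrightarrow> par 0 t u"
proof (induction arbitrary: k t rule: beta_level.induct)
  case (root s1 s2)
  from root.prems(2) obtain k' where k: "k = Suc k'" by (cases k) auto
  from root.prems(1) show ?case unfolding k
  proof (cases rule: par.cases)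
    case (app t1 t2)
    then show ?thesis
      by (auto dest!: par_LamD intro!: par.beta intro: par_antimono)
  qed
next
  case (lam j s s')
  from lam.prems(2) obtain k' where k: "k = Suc k'" by (cases k) auto
  from lam.prems(1) show ?case unfolding k
    by (cases rule: par.cases) (use lam.IH lam.prems k in \<open>auto intro: par.lam\<close>)
next
  case (appL j s s' s2)
  from appL.prems(2) obtain k' where k: "k = Suc k'" by (cases k) auto
  from appL.prems(1) show ?case unfolding k
    by (cases rule: par.cases)
       (use appL.IH appL.prems k in \<open>auto intro!: par.app intro: par_antimono\<close>)
next
  case (appR j s s' s1)
  from appR.prems(2) obtain k' where k: "k = Suc k'" by (cases k) auto
  from appR.prems(1) show ?case unfolding k
    by (cases rule: par.cases)
       (use appR.IH appR.prems k in \<open>auto intro!: par.app intro: par_antimono\<close>)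
qed

section \<open>Factoring a parallel step at a single level\<close>

definition fact_level :: "nat \<Rightarrow> lterm \<Rightarrow> lterm \<Rightarrow> bool" where
  "fact_level k t s \<longleftrightarrow> (\<exists>u. (beta_level k)\<^sup>*\<^sup>* t u \<and> par (Suc k) u s)"

lemma rtranclp_map: "r\<^sup>*\<^sup>* a b \<Longrightarrow> (\<And>a b. r a b \<Longrightarrow> r' (f a) (f b)) \<Longrightarrow> r'\<^sup>*\<^sup>* (f a) (f b)"
  by (induction rule: rtranclp_induct) (auto intro: rtranclp.rtrancl_into_rtrancl)

lemma fact_level_lift: "fact_level k t s \<Longrightarrow> fact_level k (lift c t) (lift c s)"
  unfolding fact_level_def by (blast intro: rtranclp_map beta_level_lift par_lift)

lemma fact_level_Lam: "fact_level k t s \<Longrightarrow> fact_level k (Lam t) (Lam s)"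
  unfolding fact_level_def by (blast intro: rtranclp_map beta_level.lam par.lam)

text \<open>Redexes in the argument have level at least 1 in the application, so only the function
  part has to be factored.\<close>

lemma fact_level_App_0:
  assumes "fact_level 0 t t'" "par 0 s s'"
  shows "fact_level 0 (App t s) (App t' s')"
proof -
  from assms(1) obtain u where u: "(beta_level 0)\<^sup>*\<^sup>* t u" "par (Suc 0) u t'"
    unfolding fact_level_def by blast
  have "(beta_level 0)\<^sup>*\<^sup>* (App t s) (App u s)"
    using u(1) by (rule rtranclp_map) (rule beta_level.appL)
  moreover have "par (Suc 0) (App u s) (App t' s')"
    using u(2) assms(2) by (auto intro: par.app)
  ultimately show ?thesis unfolding fact_level_def by blast
qed

lemma fact_level_App_Suc:
  assumes "fact_level (Suc k) t t'" "fact_level k s s'"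
  shows "fact_level (Suc k) (App t s) (App t' s')"
proof -
  from assms(1) obtain u where u: "(beta_level (Suc k))\<^sup>*\<^sup>* t u" "par (Suc (Suc k)) u t'"
    unfolding fact_level_def by blast
  from assms(2) obtain v where v: "(beta_level k)\<^sup>*\<^sup>* s v" "par (Suc k) v s'"
    unfolding fact_level_def by blast
  have "(beta_level (Suc k))\<^sup>*\<^sup>* (App t s) (App u s)"
    using u(1) by (rule rtranclp_map) (rule beta_level.appL)
  also have "(beta_level (Suc k))\<^sup>*\<^sup>* (App u s) (App u v)"
    using v(1) by (rule rtranclp_map) (rule beta_level.appR)
  finally have "(beta_level (Suc k))\<^sup>*\<^sup>* (App t s) (App u v)" .
  moreover have "par (Suc (Suc k)) (App u v) (App t' s')"
    using u(2) v(2) by (auto intro: par.app)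
  ultimately show ?thesis unfolding fact_level_def by blast
qed

text \<open>Copies of \<open>s\<close> outside all arguments use its factorization; copies inside
  arguments are already above level 0 and go whole, by \<open>par 0 s s'\<close>, into the final
  parallel step.\<close>

lemma fact_level_subst:
  "par (Suc 0) t t' \<Longrightarrow> par 0 s s' \<Longrightarrow> fact_level 0 s s' \<Longrightarrow>
    fact_level 0 (subst x s t) (subst x s' t')"
proof (induction "Suc 0" t t' arbitrary: x s s' rule: par.induct)
  case (var i)
  then show ?case
    by (auto simp: fact_level_def intro: par.var)
next
  case (lam t t')
  then show ?case by (simp add: fact_level_Lam par_lift fact_level_lift)
next
  case (app t t' u u')
  then show ?case by (simp add: fact_level_App_0 par_subst)
qed

lemma par_fact_level: "par k t s \<Longrightarrow> fact_level k t s"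
proof (induction rule: par.induct)
  case (var k i)
  show ?case by (auto simp: fact_level_def intro: par.var)
next
  case (lam k t t')
  then show ?case by (simp add: fact_level_Lam)
next
  case (app k t t' s s')
  show ?case
    by (cases k) (use app in \<open>auto intro: fact_level_App_0 fact_level_App_Suc\<close>)
next
  case (beta t t' s s')
  from beta.IH(1) obtain u where u: "(beta_level 0)\<^sup>*\<^sup>* t u" "par (Suc 0) u t'"
    unfolding fact_level_def by blast
  have "fact_level 0 (subst 0 s u) (subst 0 s' t')"
    using u(2) beta by (simp add: fact_level_subst)
  \<comment> \<open>The root redex is contracted first; the level-0 steps of the body remain
    possible after substituting the unreduced \<open>s\<close>.\<close>
  moreover have "(beta_level 0)\<^sup>*\<^sup>* (subst 0 s t) (subst 0 s u)"
    using u(1) by (rule rtranclp_map) (rule beta_level_subst)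
  then have "(beta_level 0)\<^sup>*\<^sup>* (App (Lam t) s) (subst 0 s u)"
    by (rule converse_rtranclp_into_rtranclp [rotated]) (rule beta_level.root)
  ultimately show ?case unfolding fact_level_def by (meson rtranclp_trans)
qed

text \<open>A contracted redex lies below \<open>k\<close> nested arguments whose applications,
  being of level below \<open>k\<close>, survive in \<open>s\<close>. The bound uses the target
  because it stays fixed while the source changes in the iteration over levels.\<close>

lemma par_eq_if_size_less: "par k t s \<Longrightarrow> size s < k \<Longrightarrow> t = s"
  by (induction rule: par.induct) auto

text \<open>Equality is a separate case because no natural number exceeds \<open>deg t\<close> when
  \<open>t\<close> is normal.\<close>

definition par_nll :: "lterm \<Rightarrow> lterm \<Rightarrow> bool" where
  "par_nll t s \<longleftrightarrow> t = s \<or> (\<exists>k. deg t < enat k \<and> par k t s)"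

lemma ll_if_beta_level: "beta_level k t s \<Longrightarrow> enat k \<le> deg t \<Longrightarrow> ll t s"
  unfolding ll_def using deg_le_beta_level [of k t s] by auto

lemma ll_if_beta_levels:
  "(beta_level k)\<^sup>*\<^sup>* t s \<Longrightarrow> enat k \<le> deg t \<Longrightarrow> ll\<^sup>*\<^sup>* t s \<and> enat k \<le> deg s"
proof (induction rule: rtranclp_induct)
  case (step u s)
  then show ?case
    using ll_if_beta_level par_le_deg par_beta_level
    by (meson rtranclp.rtrancl_into_rtrancl)
qed simp

lemma par_split_from:
  "par k t s \<Longrightarrow> enat k \<le> deg t \<Longrightarrow> \<exists>u. ll\<^sup>*\<^sup>* t u \<and> par_nll u s"
proof (induction "Suc (size s) - k" arbitrary: k t)
  case 0
  then have "t = s" by (auto intro: par_eq_if_size_less)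
  then show ?case by (auto simp: par_nll_def)
next
  case (Suc n)
  from par_fact_level [OF Suc.prems(1)]
  obtain u where u: "(beta_level k)\<^sup>*\<^sup>* t u" "par (Suc k) u s"
    unfolding fact_level_def by blast
  from ll_if_beta_levels [OF u(1) Suc.prems(2)]
  have tu: "ll\<^sup>*\<^sup>* t u" "enat k \<le> deg u" by auto
  show ?case
  \<comment> \<open>Either \<open>deg u = k\<close> and the remaining step lies above the least
    level, or no redex of level \<open>k\<close> is left and the splitting continues one level
    higher.\<close>
  proof (cases "deg u < enat (Suc k)")
    case True
    with tu u show ?thesis unfolding par_nll_def by blast
  next
    case False
    then have "enat (Suc k) \<le> deg u" by simp
    moreover have "n = Suc (size s) - Suc k" using Suc.hyps(2) by simp
    ultimately obtain v where "ll\<^sup>*\<^sup>* u v" "par_nll v s"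
      using Suc.hyps(1) u(2) by blast
    with tu(1) show ?thesis by (meson rtranclp_trans)
  qed
qed

lemma par_split: "par 0 t s \<Longrightarrow> \<exists>u. ll\<^sup>*\<^sup>* t u \<and> par_nll u s"
  by (rule par_split_from) (auto simp: zero_enat_def [symmetric])

section \<open>Factorization\<close>

text \<open>Both steps merge into one parallel step, which is split again. A single
  \<open>par_nll\<close> step comes out on the right, so it can be pushed through a whole sequence
  of \<open>ll\<close> steps.\<close>

lemma par_nll_ll_swap:
  assumes "par_nll t s" "ll s u"
  shows "\<exists>v. ll\<^sup>*\<^sup>* t v \<and> par_nll v u"
proof -
  from assms(2) obtain j where j: "enat j = deg s" "beta_level j s u"
    unfolding ll_def by blast
  have "par 0 t u"
    using assms(1) unfolding par_nll_def
  proof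
    assume "t = s"
    with j(2) show ?thesis by (auto intro: par_antimono par_beta_level)
  next
    assume "\<exists>k. deg t < enat k \<and> par k t s"
    then obtain k where k: "deg t < enat k" "par k t s" by blast
    \<comment> \<open>The parallel step preserves the least level, so
      \<open>j = deg s = deg t\<close>.\<close>
    with j(1) have "j < k" by (metis enat_ord_simps(2) par_deg_eq)
    with j(2) k(2) show ?thesis by (rule par_merge)
  qed
  then show ?thesis by (rule par_split)
qed

lemma par_nll_lls_swap:
  assumes "ll\<^sup>*\<^sup>* s u" "par_nll t s"
  shows "\<exists>v. ll\<^sup>*\<^sup>* t v \<and> par_nll v u"
  using assms
proof (induction rule: rtranclp_induct)
  case (step u w)
  then show ?case by (meson par_nll_ll_swap rtranclp_trans)
qed blast

lemma beta_imp_lls_par_nlls: "beta\<^sup>*\<^sup>* t u \<Longrightarrow> \<exists>s. ll\<^sup>*\<^sup>* t s \<and> par_nll\<^sup>*\<^sup>* s u"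
proof (induction rule: converse_rtranclp_induct)
  case (step t t')
  from step.hyps(1) have "par 0 t t'"
    unfolding beta_def by (auto intro: par_antimono par_beta_level)
  then obtain a where a: "ll\<^sup>*\<^sup>* t a" "par_nll a t'"
    using par_split by blast
  from step.IH obtain s where s: "ll\<^sup>*\<^sup>* t' s" "par_nll\<^sup>*\<^sup>* s u" by blast
  from par_nll_lls_swap [OF s(1) a(2)]
  obtain b where "ll\<^sup>*\<^sup>* a b" "par_nll b s" by blast
  with a s show ?case
    by (meson converse_rtranclp_into_rtranclp rtranclp_trans)
qed blast

text \<open>A fixed bound takes the place of the least level in \<open>nll\<close>, which depends on
  the surrounding term and would not pass through an induction on \<open>par\<close>.\<close>

definition beta_ge :: "nat \<Rightarrow> lterm \<Rightarrow> lterm \<Rightarrow> bool" where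
  "beta_ge k t s \<longleftrightarrow> (\<exists>j\<ge>k. beta_level j t s)"

lemma par_imp_beta_ges: "par k t s \<Longrightarrow> (beta_ge k)\<^sup>*\<^sup>* t s"
proof (induction rule: par.induct)
  case (lam k t t')
  from lam.IH show ?case
    by (rule rtranclp_map) (auto simp: beta_ge_def intro: beta_level.lam)
next
  case (app k t t' s s')
  have "(beta_ge k)\<^sup>*\<^sup>* (App t s) (App t' s)"
    using app.IH(1) by (rule rtranclp_map) (auto simp: beta_ge_def intro: beta_level.appL)
  also have "(beta_ge k)\<^sup>*\<^sup>* (App t' s) (App t' s')"
    using app.IH(2)
  proof (rule rtranclp_map)
    fix a b assume "beta_ge (k - 1) a b"
    then obtain j where "k - 1 \<le> j" "beta_level j a b" unfolding beta_ge_def by blast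
    \<comment> \<open>Truncation is harmless: \<open>k - 1 \<le> j\<close> yields
      \<open>k \<le> Suc j\<close> also for \<open>k = 0\<close>.\<close>
    then show "beta_ge k (App t' a) (App t' b)"
      unfolding beta_ge_def by (intro exI [of _ "Suc j"]) (auto intro: beta_level.appR)
  qed
  finally show ?case .
next
  case (beta t t' s s')
  have "(beta_ge 0)\<^sup>*\<^sup>* (App (Lam t) s) (App (Lam t') s)"
    using beta.IH(1)
    by (rule rtranclp_map) (auto simp: beta_ge_def intro: beta_level.appL beta_level.lam)
  also have "(beta_ge 0)\<^sup>*\<^sup>* (App (Lam t') s) (App (Lam t') s')"
    using beta.IH(2) by (rule rtranclp_map) (auto simp: beta_ge_def intro: beta_level.appR)
  also have "beta_ge 0 (App (Lam t') s') (subst 0 s' t')"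
    by (auto simp: beta_ge_def intro: beta_level.root)
  finally show ?case .
qed simp

lemma beta_ge_deg_eq: "beta_ge k t s \<Longrightarrow> deg t < enat k \<Longrightarrow> deg s = deg t"
  unfolding beta_ge_def by (blast intro: par_deg_eq par_antimono par_beta_level)

lemma beta_ge_imp_nll: "beta_ge k t s \<Longrightarrow> deg t < enat k \<Longrightarrow> nll t s"
  unfolding beta_ge_def nll_def by (meson enat_ord_simps(1) less_le_trans)

text \<open>A least level below \<open>k\<close> does not change under such steps, so the same bound
  serves along the whole sequence.\<close>

lemma beta_ges_imp_nlls:
  "(beta_ge k)\<^sup>*\<^sup>* t s \<Longrightarrow> deg t < enat k \<Longrightarrow> nll\<^sup>*\<^sup>* t s"
proof (induction rule: converse_rtranclp_induct)
  case (step t u)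
  then have "nll t u" "nll\<^sup>*\<^sup>* u s"
    by (simp_all add: beta_ge_imp_nll beta_ge_deg_eq)
  then show ?case by (rule converse_rtranclp_into_rtranclp)
qed simp

lemma par_nll_imp_nlls: "par_nll t s \<Longrightarrow> nll\<^sup>*\<^sup>* t s"
  unfolding par_nll_def by (auto intro: beta_ges_imp_nlls par_imp_beta_ges)

lemma ll_factorization:
  assumes "beta\<^sup>*\<^sup>* t u"
  shows "\<exists>s. ll\<^sup>*\<^sup>* t s \<and> nll\<^sup>*\<^sup>* s u"
proof -
  from beta_imp_lls_par_nlls [OF assms]
  obtain s where s: "ll\<^sup>*\<^sup>* t s" "par_nll\<^sup>*\<^sup>* s u" by blast
  from s(2) have "nll\<^sup>*\<^sup>* s u"
    by (induction rule: rtranclp_induct) (auto dest: par_nll_imp_nlls)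
  with s(1) show ?thesis by blast
qed

section \<open>Normalization\<close>

lemma strongly_normalizing_if_diamond:
  assumes diamond: "\<And>t s1 s2. r t s1 \<Longrightarrow> r t s2 \<Longrightarrow> s1 = s2 \<or> (\<exists>u. r s1 u \<and> r s2 u)"
    and "weakly_normalizing r t"
  shows "strongly_normalizing r t"
proof -
  from assms(2) obtain s where "r\<^sup>*\<^sup>* t s" and s: "normal r s"
    unfolding weakly_normalizing_def by blast
  then obtain n where n: "(r ^^ n) t s" by (auto simp: rtranclp_power)
  \<comment> \<open>Random descent: since the diamond closes with exactly one step on each side, any
    first step extends to a path to \<open>s\<close> of the same total length. An infinite sequence
    would outrun this length.\<close>
  have descent: "\<exists>m. n = Suc m \<and> (r ^^ m) t' s" if "(r ^^ n) t s" "r t t'" for n t t'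
    using that
  proof (induction n arbitrary: t t')
    case 0
    with s show ?case by (auto simp: normal_def)
  next
    case (Suc n)
    from Suc.prems(1) obtain t1 where t1: "r t t1" "(r ^^ n) t1 s"
      by (metis relpowp_Suc_D2)
    show ?case
    proof (cases "t1 = t'")
      case True
      with t1 show ?thesis by blast
    next
      case False
      with diamond t1(1) Suc.prems(2) obtain u where u: "r t1 u" "r t' u" by blast
      from Suc.IH [OF t1(2) u(1)] obtain m where "n = Suc m" "(r ^^ m) u s" by blast
      with u(2) have "(r ^^ n) t' s" by (metis relpowp_Suc_I2)
      then show ?thesis by blast
    qed
  qed
  show ?thesis
    unfolding strongly_normalizing_def
  proof
    assume "\<exists>f. f 0 = t \<and> (\<forall>i. r (f i) (f (Suc i)))"
    then obtain f where f: "f 0 = t" "\<And>i. r (f i) (f (Suc i))" by blast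
    have "\<exists>m. n = m + i \<and> (r ^^ m) (f i) s" for i
    proof (induction i)
      case 0
      with n f(1) show ?case by simp
    next
      case (Suc i)
      with descent f(2) show ?case by (metis add_Suc_shift)
    qed
    from this [of "Suc n"] show False by simp
  qed
qed

text \<open>Both steps have level \<open>k = deg t\<close>, and the closing steps of level
  \<open>k\<close> are again of least level because \<open>deg\<close> cannot fall below
  \<open>k\<close>.\<close>

lemma ll_diamond:
  assumes "ll t s1" "ll t s2"
  shows "s1 = s2 \<or> (\<exists>u. ll s1 u \<and> ll s2 u)"
proof -
  from assms obtain k where k: "enat k = deg t" "beta_level k t s1" "beta_level k t s2"
    unfolding ll_def by (metis enat.inject)
  then have "enat k \<le> deg s1" "enat k \<le> deg s2"
    using par_le_deg par_beta_level by (metis order_refl)+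
  with beta_level_diamond [OF k(2,3)] show ?thesis
    by (blast intro: ll_if_beta_level)
qed

lemma ll_imp_beta: "ll t s \<Longrightarrow> beta t s"
  unfolding ll_def beta_def by blast

lemma normal_beta_iff_deg: "normal beta t \<longleftrightarrow> deg t = \<infinity>"
  unfolding normal_def beta_def
  by (metis beta_level_deg deg_le_beta_level enat_ord_simps(5) not_infinity_eq)

lemma normal_ll_iff_deg: "normal ll t \<longleftrightarrow> deg t = \<infinity>"
  unfolding normal_def ll_def
  by (metis beta_level_deg enat.distinct(2) not_infinity_eq)

lemma nll_deg_eq: "nll t s \<Longrightarrow> deg s = deg t"
  unfolding nll_def by (auto intro: par_deg_eq par_beta_level)

text \<open>An \<open>nll\<close> step starts from a finite least level and preserves it, so its
  target still has a redex and the sequence must be empty.\<close>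

lemma nlls_normal_eq:
  assumes "nll\<^sup>*\<^sup>* t s" "normal beta s"
  shows "t = s"
  using assms(1)
proof (cases rule: rtranclp.cases)
  case (rtrancl_into_rtrancl u)
  then have "deg s \<noteq> \<infinity>"
    using nll_deg_eq [of u s] by (cases "deg u") (auto simp: nll_def)
  with assms(2) show ?thesis by (simp add: normal_beta_iff_deg)
qed simp

lemma ll_normalizing_reduction: "normalizing_reduction_for ll beta"
proof -
  have "strongly_normalizing ll t" if "weakly_normalizing beta t" for t
  proof -
    from that obtain s where s: "beta\<^sup>*\<^sup>* t s" "normal beta s"
      unfolding weakly_normalizing_def by blast
    with ll_factorization [OF s(1)] have "ll\<^sup>*\<^sup>* t s"
      by (auto dest: nlls_normal_eq)
    with s(2) have "weakly_normalizing ll t"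
      unfolding weakly_normalizing_def by (auto simp: normal_beta_iff_deg normal_ll_iff_deg)
    then show ?thesis
      using strongly_normalizing_if_diamond ll_diamond by metis
  qed
  then show ?thesis
    unfolding normalizing_reduction_for_def
    by (auto simp: normal_beta_iff_deg normal_ll_iff_deg ll_imp_beta)
qed

theorem theorem8:
  shows "(\<forall>t u. beta\<^sup>*\<^sup>* t u \<longrightarrow> (\<exists>s. ll\<^sup>*\<^sup>* t s \<and> nll\<^sup>*\<^sup>* s u)) \<and>
    normalizing_reduction_for ll beta"
  using ll_factorization ll_normalizing_reduction by blast

end
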